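(* Let $\mathcal{K}_n$ denote the $n$-th generation of the four-corner Cantor set. Then $\operatorname{Fav}(\mathcal{K}_n) \gtrsim \frac{1}{n}$; that is, there exists an absolute constant $c > 0$ such that $\operatorname{Fav}(\mathcal{K}_n) \ge \frac{c}{n}$ for all integers $n \ge 1$.
   Context: The Favard length of a set $E \subseteq \mathbb{R}^2$ is $\operatorname{Fav}(E) = \int_0^{2\pi} |\pi_\theta E| \, d\theta$, where $\pi_\theta$ is orthogonal projection of $\mathbb{R}^2$ onto the line $L_\theta$ through the origin at angle $\theta$ to the positive $x$-axis, and $|\cdot|$ is one-dimensional Lebesgue measure (length) within $L_\theta$. The generations of the four-corner Cantor set are defined by $\mathcal{K}_0 = [0,1]^2$ and $\mathcal{K}_{n} = \bigcup_{i=1}^4 f_i(\mathcal{K}_{n-1})$ for $n \ge 1$, where $f_i(z) = \frac{1}{4} z + \beta_i$ with $\{\beta_i : 1 \le i \le 4\} = \{(0,0), (0,3/4), (3/4,0), (3/4,3/4)\}$. Equivalently, $\mathcal{K}_n$ is obtained from $\mathcal{K}_{n-1}$ by dividing each of its squares into a $4 \times 4$ grid of equal subsquares and keeping the four corner subsquares, so that $\mathcal{K}_n$ is a union of $4^n$ squares of sidelength $4^{-n}$. *)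

theory Defs
  imports "HOL-Analysis.Analysis"
begin

text \<open>The plane is \<^typ>\<open>real \<times> real\<close>, whose library inner product and norm are the Euclidean ones.\<close>

definition direction :: "real \<Rightarrow> real \<times> real" where
  "direction \<theta> = (cos \<theta>, sin \<theta>)"

definition line_proj :: "real \<Rightarrow> real \<times> real \<Rightarrow> real \<times> real" where
  "line_proj \<theta> z = (z \<bullet> direction \<theta>) *\<^sub>R direction \<theta>"

text \<open>Since the direction vector has norm 1, \<open>t \<mapsto> t *\<^sub>R direction \<theta>\<close> is an isometry of the real
  line onto the line at angle \<open>\<theta>\<close>; length within that line is transported along it.\<close>

definition line_length :: "real \<Rightarrow> (real \<times> real) set \<Rightarrow> ennreal" where
  "line_length \<theta> A = emeasure lebesgue {t :: real. t *\<^sub>R direction \<theta> \<in> A}"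

text \<open>The integral is taken in \<^typ>\<open>ennreal\<close>, so that no integrability assumption is needed.\<close>

definition favard_length :: "(real \<times> real) set \<Rightarrow> ennreal" where
  "favard_length E = (\<integral>\<^sup>+\<theta>\<in>{0..2 * pi}. line_length \<theta> (line_proj \<theta> ` E) \<partial>lebesgue)"

definition corners :: "(real \<times> real) set" where
  "corners = {(0, 0), (0, 3/4), (3/4, 0), (3/4, 3/4)}"

primrec four_corner_gen :: "nat \<Rightarrow> (real \<times> real) set" where
  "four_corner_gen 0 = {0..1} \<times> {0..1}"
| "four_corner_gen (Suc n) = (\<Union>\<beta>\<in>corners. (\<lambda>z. (1/4) *\<^sub>R z + \<beta>) ` four_corner_gen n)"

end

theory Submission
  imports Defs
begin

text \<open>
  The bound comes from a second moment argument. Fix \<open>n\<close>, put \<open>r = (1/4) ^ n\<close>, and take \<open>\<theta>\<close> in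
  \<open>{0..1}\<close>, so that both coordinates of the direction are nonnegative. Each of the \<open>4 ^ n\<close> squares
  of side \<open>r\<close> then casts a projection containing the interval of length \<open>r\<close> that starts at the
  projection of its lower left vertex. Let \<open>g\<close> count how many of these intervals cover a point of
  the line. The integral of \<open>g\<close> is \<open>4 ^ n * r = 1\<close> for every \<open>\<theta>\<close>, so its support, and with it the
  projection, can be short only if \<open>g\<close> is concentrated, that is, if the integral of \<open>g\<^sup>2\<close> is large.
  This is quantified by \<open>2 \<mu> g \<le> 1 + \<mu>\<^sup>2 g\<^sup>2\<close> on the support of \<open>g\<close>, a form of
  Cauchy--Schwarz that is linear in the measure of the support and hence passes directly through
  the integration over \<open>\<theta>\<close>.

  The integral of \<open>g\<^sup>2\<close> over the line and over \<open>\<theta>\<close> is a sum over pairs of squares. Two intervals with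
  left ends coming from vertices \<open>c\<close> and \<open>d\<close> meet only if \<open>\<theta>\<close> satisfies
  \<open>\<bar>(c - d) \<bullet> direction \<theta>\<bar> \<le> r\<close>, which for \<open>c \<noteq> d\<close> confines \<open>\<theta>\<close> to a set of measure at most
  \<open>16 r / norm (c - d)\<close> (\<open>emeasure_slab_directions\<close>). What is left is the discrete Riesz energy of
  exponent 1 of the vertices. Self-similarity gives it the recursion \<open>energy_Suc_le\<close>: each of the \<open>n\<close>
  scales contributes the same amount, at most \<open>3/2 * 16 ^ n\<close>, since the set has dimension exactly
  1. Hence the second moment is at most \<open>25 n\<close>, and \<open>\<mu> = 1 / (25 n)\<close> yields the theorem.
\<close>

section \<open>A second moment bound for finite unions\<close>

text \<open>Integrate \<open>2 \<mu> g \<le> 1\<^bsub>U\<^esub> + \<mu>\<^sup>2 g\<^sup>2\<close>, where \<open>g\<close> counts the sets containing a point and \<open>U\<close>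
  is their union. On \<open>U\<close> this is \<open>(1 - \<mu> g)\<^sup>2 \<ge> 0\<close>, and off \<open>U\<close> both sides vanish.\<close>

lemma second_moment_union_bound:
  fixes I :: "'i \<Rightarrow> 'a set" and \<mu> :: real
  assumes J: "finite J" and meas: "\<And>i. i \<in> J \<Longrightarrow> I i \<in> sets M" and l: "\<mu> \<ge> 0"
  shows "ennreal (2 * \<mu>) * (\<Sum>i\<in>J. emeasure M (I i))
    \<le> emeasure M (\<Union>i\<in>J. I i) + ennreal (\<mu>\<^sup>2) * (\<Sum>i\<in>J. \<Sum>j\<in>J. emeasure M (I i \<inter> I j))"
proof -
  let ?g = "\<lambda>t. \<Sum>i\<in>J. indicator (I i) t :: real"
  have pw: "ennreal (2 * \<mu>) * (\<Sum>i\<in>J. indicator (I i) t)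
      \<le> indicator (\<Union>i\<in>J. I i) t + ennreal (\<mu>\<^sup>2) * (\<Sum>i\<in>J. \<Sum>j\<in>J. indicator (I i \<inter> I j) t)" for t
  proof -
    have g0: "?g t \<ge> 0"
      by (simp add: sum_nonneg)
    have real: "2 * \<mu> * ?g t \<le> indicator (\<Union>i\<in>J. I i) t + \<mu>\<^sup>2 * (?g t)\<^sup>2"
    proof (cases "t \<in> (\<Union>i\<in>J. I i)")
      case True
      have "0 \<le> (1 - \<mu> * ?g t)\<^sup>2"
        by simp
      then have "2 * \<mu> * ?g t \<le> 1 + \<mu>\<^sup>2 * (?g t)\<^sup>2"
        by (simp add: power2_eq_square algebra_simps)
      then show ?thesis
        using True by simp
    next
      case False
      then have "?g t = 0"
        by (intro sum.neutral) auto
      then show ?thesis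
        by simp
    qed
    have "ennreal (2 * \<mu> * ?g t) \<le> ennreal (indicator (\<Union>i\<in>J. I i) t + \<mu>\<^sup>2 * (?g t)\<^sup>2)"
      by (rule ennreal_leI[OF real])
    moreover have "ennreal (2 * \<mu> * ?g t) = ennreal (2 * \<mu>) * (\<Sum>i\<in>J. indicator (I i) t)"
      using l g0 by (simp add: ennreal_mult sum_ennreal[symmetric] ennreal_indicator)
    moreover have "ennreal (indicator (\<Union>i\<in>J. I i) t + \<mu>\<^sup>2 * (?g t)\<^sup>2)
        = indicator (\<Union>i\<in>J. I i) t + ennreal (\<mu>\<^sup>2) * ennreal ((?g t)\<^sup>2)"
      by (simp add: ennreal_plus ennreal_mult ennreal_indicator)
    moreover have "ennreal ((?g t)\<^sup>2) = (\<Sum>i\<in>J. \<Sum>j\<in>J. indicator (I i \<inter> I j) t)"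
    proof -
      have "(?g t)\<^sup>2 = (\<Sum>i\<in>J. \<Sum>j\<in>J. indicator (I i \<inter> I j) t)"
        by (simp add: power2_eq_square sum_product indicator_inter_arith)
      then show ?thesis
        by (simp add: sum_ennreal[symmetric] ennreal_indicator sum_nonneg)
    qed
    ultimately show ?thesis
      by simp
  qed
  have "ennreal (2 * \<mu>) * (\<Sum>i\<in>J. emeasure M (I i))
      = (\<integral>\<^sup>+t. ennreal (2 * \<mu>) * (\<Sum>i\<in>J. indicator (I i) t) \<partial>M)"
    using meas by (simp add: nn_integral_cmult nn_integral_sum)
  also have "\<dots> \<le> (\<integral>\<^sup>+t. indicator (\<Union>i\<in>J. I i) t
      + ennreal (\<mu>\<^sup>2) * (\<Sum>i\<in>J. \<Sum>j\<in>J. indicator (I i \<inter> I j) t) \<partial>M)"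
    by (intro nn_integral_mono pw)
  also have "\<dots> = emeasure M (\<Union>i\<in>J. I i)
      + ennreal (\<mu>\<^sup>2) * (\<Sum>i\<in>J. \<Sum>j\<in>J. emeasure M (I i \<inter> I j))"
  proof -
    have U: "(\<Union>i\<in>J. I i) \<in> sets M"
      using J meas by auto
    have IJ: "I i \<inter> I j \<in> sets M" if "i \<in> J" "j \<in> J" for i j
      using that meas by auto
    have m2: "(\<lambda>t. \<Sum>i\<in>J. \<Sum>j\<in>J. indicator (I i \<inter> I j) t :: ennreal) \<in> borel_measurable M"
      using IJ by (intro borel_measurable_sum borel_measurable_indicator) auto
    have "(\<integral>\<^sup>+t. (\<Sum>i\<in>J. \<Sum>j\<in>J. indicator (I i \<inter> I j) t) \<partial>M)
        = (\<Sum>i\<in>J. \<integral>\<^sup>+t. (\<Sum>j\<in>J. indicator (I i \<inter> I j) t) \<partial>M)"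
      using IJ by (intro nn_integral_sum borel_measurable_sum borel_measurable_indicator) auto
    also have "\<dots> = (\<Sum>i\<in>J. \<Sum>j\<in>J. \<integral>\<^sup>+t. indicator (I i \<inter> I j) t \<partial>M)"
      using IJ by (intro sum.cong refl nn_integral_sum borel_measurable_indicator) auto
    also have "\<dots> = (\<Sum>i\<in>J. \<Sum>j\<in>J. emeasure M (I i \<inter> I j))"
      using IJ by (intro sum.cong refl nn_integral_indicator) auto
    finally show ?thesis
      using U m2 by (simp add: nn_integral_add nn_integral_cmult)
  qed
  finally show ?thesis .
qed

text \<open>The point is that \<open>L\<close> may be non-measurable, which rules out splitting the integral of
  \<open>L x + h x\<close>. Instead \<open>f\<close> is split into the measurable functions \<open>f - h\<close>, which lies below \<open>L\<close>,
  and \<open>h\<close>. It is applied with \<open>L\<close> the length of the projection as a function of the angle, so that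
  measurability of this function never has to be established. Finiteness of \<open>f\<close> excludes the
  value \<open>top - top = top\<close> of the truncated subtraction.\<close>

lemma nn_integral_le_add_measurable:
  assumes f: "f \<in> borel_measurable M" and h: "h \<in> borel_measurable M"
    and fin: "\<And>x. f x \<noteq> top" and le: "\<And>x. x \<in> space M \<Longrightarrow> f x \<le> L x + h x"
  shows "(\<integral>\<^sup>+x. f x \<partial>M) \<le> (\<integral>\<^sup>+x. L x \<partial>M) + (\<integral>\<^sup>+x. h x \<partial>M)"
proof -
  have "(\<integral>\<^sup>+x. f x \<partial>M) \<le> (\<integral>\<^sup>+x. (f x - h x) + h x \<partial>M)"
    by (intro nn_integral_mono) (auto simp: diff_add_self_ennreal)
  also have "\<dots> = (\<integral>\<^sup>+x. f x - h x \<partial>M) + (\<integral>\<^sup>+x. h x \<partial>M)"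
    using f h by (intro nn_integral_add) auto
  also have "(\<integral>\<^sup>+x. f x - h x \<partial>M) \<le> (\<integral>\<^sup>+x. L x \<partial>M)"
  proof (intro nn_integral_mono)
    fix x assume "x \<in> space M"
    then have "f x \<le> h x + L x"
      using le[of x] by (simp add: add.commute)
    then show "f x - h x \<le> L x"
      using fin[of x] by (simp add: ennreal_minus_le_iff)
  qed
  finally show ?thesis
    by (simp add: add_right_mono)
qed

section \<open>Directions that nearly annihilate a vector\<close>

text \<open>The derivative \<open>2 * cos x - 1\<close> of \<open>2 * sin x - x\<close> is nonnegative up to \<open>pi / 3 > 1\<close>.\<close>

lemma abs_le_two_abs_sin:
  fixes u :: real
  assumes "\<bar>u\<bar> \<le> 1"
  shows "\<bar>u\<bar> \<le> 2 * \<bar>sin u\<bar>"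
proof -
  have "2 * sin 0 - 0 \<le> 2 * sin \<bar>u\<bar> - \<bar>u\<bar>"
  proof (rule DERIV_nonneg_imp_nondecreasing[where f = "\<lambda>x. 2 * sin x - x"])
    fix x :: real assume x: "0 \<le> x" "x \<le> \<bar>u\<bar>"
    then have "cos (pi / 3) \<le> cos x"
      using assms pi_gt3 by (intro cos_monotone_0_pi_le) auto
    then have "0 \<le> 2 * cos x - 1"
      by (simp add: cos_60)
    moreover have "((\<lambda>x. 2 * sin x - x) has_real_derivative 2 * cos x - 1) (at x)"
      by (auto intro!: derivative_eq_intros)
    ultimately show "\<exists>y. ((\<lambda>x. 2 * sin x - x) has_real_derivative y) (at x) \<and> 0 \<le> y"
      by blast
  qed simp
  then show ?thesis
    by (auto simp: abs_if split: if_splits)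
qed

definition slab_directions :: "real \<Rightarrow> real \<times> real \<Rightarrow> real set" where
  "slab_directions r d = {\<theta> \<in> {0..1}. \<bar>d \<bullet> direction \<theta>\<bar> \<le> r}"

lemma slab_directions_sets [measurable]: "slab_directions r d \<in> sets lebesgue"
proof -
  have "slab_directions r d = {0..1} \<inter> {\<theta>. \<bar>d \<bullet> direction \<theta>\<bar> \<le> r}"
    by (auto simp: slab_directions_def)
  moreover have "closed {\<theta>. \<bar>d \<bullet> direction \<theta>\<bar> \<le> r}"
    unfolding direction_def by (intro closed_Collect_le continuous_intros)
  ultimately have "closed (slab_directions r d)"
    by (simp add: closed_Int)
  then show ?thesis
    by auto
qed

text \<open>If \<open>d\<close> has inner products \<open>p\<close> and \<open>q\<close> with two unit vectors at angle \<open>u\<close>, then by Cramer's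
  rule each coordinate of \<open>sin u *\<^sub>R d\<close> is a combination of \<open>p\<close> and \<open>q\<close> with coefficients of modulus at
  most 1. So two directions that are both nearly orthogonal to a long vector are nearly equal.
  Restricting angles to \<open>{0..1}\<close> keeps \<open>u\<close> away from \<open>pi\<close>, where the sine vanishes again.\<close>

lemma slab_directions_close:
  assumes "\<theta> \<in> slab_directions r d" "\<phi> \<in> slab_directions r d"
  shows "norm d * \<bar>\<phi> - \<theta>\<bar> \<le> 8 * r"
proof -
  obtain a b where d: "d = (a, b)"
    by fastforce
  define p where "p = a * cos \<theta> + b * sin \<theta>"
  define q where "q = a * cos \<phi> + b * sin \<phi>"
  have p: "\<bar>p\<bar> \<le> r" and q: "\<bar>q\<bar> \<le> r" and u: "\<bar>\<phi> - \<theta>\<bar> \<le> 1"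
    using assms by (auto simp: slab_directions_def direction_def d p_def q_def)
  have shrink: "\<bar>x * y\<bar> \<le> r" if "\<bar>x\<bar> \<le> r" "\<bar>y\<bar> \<le> 1" for x y :: real
    using that mult_mono[of "\<bar>x\<bar>" r "\<bar>y\<bar>" 1] by (auto simp: abs_mult)
  have A: "\<bar>a * sin (\<phi> - \<theta>)\<bar> \<le> 2 * r"
  proof -
    have "a * sin (\<phi> - \<theta>) = p * sin \<phi> - q * sin \<theta>"
      by (simp add: p_def q_def sin_diff algebra_simps)
    moreover have "\<bar>p * sin \<phi>\<bar> \<le> r" "\<bar>q * sin \<theta>\<bar> \<le> r"
      using p q by (auto intro!: shrink)
    ultimately show ?thesis
      by linarith
  qed
  have B: "\<bar>b * sin (\<phi> - \<theta>)\<bar> \<le> 2 * r"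
  proof -
    have "b * sin (\<phi> - \<theta>) = q * cos \<theta> - p * cos \<phi>"
      by (simp add: p_def q_def sin_diff algebra_simps)
    moreover have "\<bar>q * cos \<theta>\<bar> \<le> r" "\<bar>p * cos \<phi>\<bar> \<le> r"
      using p q by (auto intro!: shrink)
    ultimately show ?thesis
      by linarith
  qed
  have "norm d * \<bar>\<phi> - \<theta>\<bar> \<le> (\<bar>a\<bar> + \<bar>b\<bar>) * (2 * \<bar>sin (\<phi> - \<theta>)\<bar>)"
    using norm_Pair_le[of a b] abs_le_two_abs_sin[OF u] by (intro mult_mono) (auto simp: d)
  also have "\<dots> \<le> 8 * r"
    using A B by (simp add: abs_mult algebra_simps)
  finally show ?thesis .
qed

lemma emeasure_slab_directions_le_one: "emeasure lebesgue (slab_directions r d) \<le> 1"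
proof -
  have "emeasure lebesgue (slab_directions r d) \<le> emeasure lebesgue {0..1::real}"
    by (intro emeasure_mono) (auto simp: slab_directions_def)
  then show ?thesis
    by simp
qed

lemma emeasure_slab_directions:
  assumes "d \<noteq> 0"
  shows "emeasure lebesgue (slab_directions r d) \<le> ennreal (16 * r * inverse (norm d))"
proof (cases "slab_directions r d = {}")
  case False
  then obtain \<theta> where \<theta>: "\<theta> \<in> slab_directions r d"
    by auto
  define s where "s = 8 * r * inverse (norm d)"
  have r: "r \<ge> 0"
    using \<theta> by (auto simp: slab_directions_def)
  have s: "s \<ge> 0"
    using r by (simp add: s_def)
  have "slab_directions r d \<subseteq> {\<theta> - s..\<theta> + s}"
  proof
    fix \<phi> assume "\<phi> \<in> slab_directions r d"
    from slab_directions_close[OF \<theta> this] have "\<bar>\<phi> - \<theta>\<bar> \<le> s"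
      using assms by (simp add: s_def field_simps)
    then show "\<phi> \<in> {\<theta> - s..\<theta> + s}"
      by (auto simp: abs_le_iff)
  qed
  then have "emeasure lebesgue (slab_directions r d) \<le> emeasure lebesgue {\<theta> - s..\<theta> + s}"
    by (intro emeasure_mono) auto
  also have "\<dots> = ennreal (16 * r * inverse (norm d))"
    using s by (simp add: s_def)
  finally show ?thesis .
qed simp

section \<open>The squares of a generation and their energy\<close>

text \<open>The lower left vertices of the squares, generated by the same maps as the squares.\<close>

primrec vertices :: "nat \<Rightarrow> (real \<times> real) set" where
  "vertices 0 = {0}"
| "vertices (Suc n) = (\<Union>\<beta>\<in>corners. (\<lambda>z. (1/4) *\<^sub>R z + \<beta>) ` vertices n)"

lemma finite_corners [simp]: "finite corners"
  and card_corners: "card corners = 4"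
  by (auto simp: corners_def)

lemma finite_vertices [simp]: "finite (vertices n)"
  by (induction n) auto

lemma vertices_in_unit_square: "vertices n \<subseteq> {0..1} \<times> {0..1}"
proof (induction n)
  case (Suc n)
  then show ?case
    by (fastforce simp: corners_def)
qed (auto simp: zero_prod_def)

text \<open>In some coordinate the two corners differ by \<open>3/4\<close>, of which the scaled points can
  take back at most \<open>1/4\<close>.\<close>

lemma norm_diff_different_corners_ge:
  assumes "\<beta> \<in> corners" "\<gamma> \<in> corners" "\<beta> \<noteq> \<gamma>" "c \<in> {0..1} \<times> {0..1}" "d \<in> {0..1} \<times> {0..1}"
  shows "1/2 \<le> norm (((1/4) *\<^sub>R c + \<beta>) - ((1/4) *\<^sub>R d + \<gamma>))"
proof -
  let ?v = "((1/4) *\<^sub>R c + \<beta>) - ((1/4) *\<^sub>R d + \<gamma>)"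
  have "1/2 \<le> \<bar>fst ?v\<bar> \<or> 1/2 \<le> \<bar>snd ?v\<bar>"
    using assms by (cases c; cases d) (auto simp: corners_def abs_real_def)
  then show ?thesis
    using norm_fst_le[of "fst ?v" "snd ?v"] norm_snd_le[of "snd ?v" "fst ?v"]
    unfolding prod.collapse real_norm_def by linarith
qed

lemma sum_vertices_Suc:
  fixes f :: "real \<times> real \<Rightarrow> 'a::comm_monoid_add"
  shows "sum f (vertices (Suc n)) = (\<Sum>\<beta>\<in>corners. \<Sum>c\<in>vertices n. f ((1/4) *\<^sub>R c + \<beta>))"
proof -
  let ?F = "\<lambda>\<beta>. (\<lambda>z. (1/4) *\<^sub>R z + \<beta>) ` vertices n"
  have disj: "?F \<beta> \<inter> ?F \<gamma> = {}" if bg: "\<beta> \<in> corners" "\<gamma> \<in> corners" "\<beta> \<noteq> \<gamma>" for \<beta> \<gamma>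
  proof (rule ccontr)
    assume "?F \<beta> \<inter> ?F \<gamma> \<noteq> {}"
    then obtain c d where cd: "c \<in> vertices n" "d \<in> vertices n"
      and eq: "(1/4) *\<^sub>R c + \<beta> = (1/4) *\<^sub>R d + \<gamma>"
      by blast
    have "1/2 \<le> norm (((1/4) *\<^sub>R c + \<beta>) - ((1/4) *\<^sub>R d + \<gamma>))"
      using norm_diff_different_corners_ge[OF bg] cd vertices_in_unit_square[of n] by blast
    then show False
      by (simp add: eq)
  qed
  have "sum f (vertices (Suc n)) = (\<Sum>\<beta>\<in>corners. sum f (?F \<beta>))"
    unfolding vertices.simps using disj by (intro sum.UNION_disjoint) auto
  also have "\<dots> = (\<Sum>\<beta>\<in>corners. \<Sum>c\<in>vertices n. f ((1/4) *\<^sub>R c + \<beta>))"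
  proof (rule sum.cong[OF refl])
    fix \<beta>
    have "inj_on (\<lambda>z. (1/4) *\<^sub>R z + \<beta>) (vertices n)"
      by (simp add: inj_on_def)
    then show "sum f (?F \<beta>) = (\<Sum>c\<in>vertices n. f ((1/4) *\<^sub>R c + \<beta>))"
      by (simp add: sum.reindex)
  qed
  finally show ?thesis .
qed

lemma card_vertices: "card (vertices n) = 4 ^ n"
proof (induction n)
  case (Suc n)
  then show ?case
    using sum_vertices_Suc[of "\<lambda>_. 1 :: nat" n] by (simp add: card_corners)
qed simp

lemma square_subset_four_corner_gen:
  assumes "c \<in> vertices n" "0 \<le> x" "x \<le> (1/4) ^ n" "0 \<le> y" "y \<le> (1/4) ^ n"
  shows "c + (x, y) \<in> four_corner_gen n"
  using assms
proof (induction n arbitrary: c x y)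
  case (Suc n)
  then obtain \<beta> c' where c: "\<beta> \<in> corners" "c' \<in> vertices n" "c = (1/4) *\<^sub>R c' + \<beta>"
    by auto
  have "c' + (4 * x, 4 * y) \<in> four_corner_gen n"
    using Suc.prems c(2) by (intro Suc.IH) (auto simp: field_simps)
  moreover have "c + (x, y) = (1/4) *\<^sub>R (c' + (4 * x, 4 * y)) + \<beta>"
    by (simp add: c(3) scaleR_add_right)
  ultimately show ?case
    using c(1) by auto
qed auto

text \<open>Compactness passes to the projections and makes them measurable, so that their length is
  bounded below by the measure of any subset.\<close>

lemma compact_four_corner_gen: "compact (four_corner_gen n)"
proof (induction n)
  case (Suc n)
  then show ?case
    by (auto intro!: compact_UN compact_continuous_image continuous_intros)
qed (auto intro!: compact_Times)

text \<open>The Riesz energy of exponent 1. The diagonal terms vanish because \<open>inverse 0 = 0\<close>.\<close>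

definition energy :: "nat \<Rightarrow> real" where
  "energy n = (\<Sum>c\<in>vertices n. \<Sum>d\<in>vertices n. inverse (norm (c - d)))"

text \<open>Pairs inside one of the four copies see distances scaled by \<open>1/4\<close>, which accounts for
  \<open>4 * 4\<close> times the previous energy. The other 12 ordered pairs of copies contain \<open>16 ^ n\<close> pairs of
  vertices each, all at distance at least \<open>1/2\<close>.\<close>

lemma energy_Suc_le: "energy (Suc n) \<le> 16 * energy n + 24 * 16 ^ n"
proof -
  let ?T = "\<lambda>\<beta> c. (1/4) *\<^sub>R c + \<beta> :: real \<times> real"
  let ?K = "\<lambda>\<beta> \<gamma>. \<Sum>c\<in>vertices n. \<Sum>d\<in>vertices n. inverse (norm (?T \<beta> c - ?T \<gamma> d))"
  have same: "?K \<beta> \<beta> = 4 * energy n" for \<beta>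
  proof -
    have "?T \<beta> c - ?T \<beta> d = (1/4) *\<^sub>R (c - d)" for c d
      by (simp add: scaleR_diff_right)
    then show ?thesis
      by (simp add: energy_def sum_distrib_left inverse_eq_divide)
  qed
  have diff: "?K \<beta> \<gamma> \<le> 2 * 16 ^ n" if "\<beta> \<in> corners" "\<gamma> \<in> corners" "\<beta> \<noteq> \<gamma>" for \<beta> \<gamma>
  proof -
    have "?K \<beta> \<gamma> \<le> (\<Sum>c\<in>vertices n. \<Sum>d\<in>vertices n. 2)"
    proof (intro sum_mono)
      fix c d assume "c \<in> vertices n" "d \<in> vertices n"
      then have "1/2 \<le> norm (?T \<beta> c - ?T \<gamma> d)"
        using norm_diff_different_corners_ge[OF that] vertices_in_unit_square[of n] by blast
      from le_imp_inverse_le[OF this] show "inverse (norm (?T \<beta> c - ?T \<gamma> d)) \<le> 2"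
        by simp
    qed
    also have "\<dots> = 2 * 16 ^ n"
      by (simp add: card_vertices power_mult_distrib[symmetric])
    finally show ?thesis .
  qed
  have "energy (Suc n) = (\<Sum>\<beta>\<in>corners. \<Sum>\<gamma>\<in>corners. ?K \<beta> \<gamma>)"
    unfolding energy_def sum_vertices_Suc by (intro sum.cong refl sum.swap)
  also have "\<dots> \<le> (\<Sum>\<beta>\<in>corners. \<Sum>\<gamma>\<in>corners. if \<beta> = \<gamma> then 4 * energy n else 2 * 16 ^ n)"
  proof (intro sum_mono)
    fix \<beta> \<gamma> assume "\<beta> \<in> corners" "\<gamma> \<in> corners"
    then show "?K \<beta> \<gamma> \<le> (if \<beta> = \<gamma> then 4 * energy n else 2 * 16 ^ n)"
      using same[of \<beta>] diff[of \<beta> \<gamma>]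
      by (cases "\<beta> = \<gamma>") (simp_all only: simp_thms if_True if_False order_refl)
  qed
  also have "\<dots> = 16 * energy n + 24 * 16 ^ n"
    by (simp add: corners_def)
  finally show ?thesis .
qed

lemma energy_le: "energy n \<le> 3/2 * real n * 16 ^ n"
proof (induction n)
  case 0
  then show ?case
    by (simp add: energy_def)
next
  case (Suc n)
  then show ?case
    using energy_Suc_le[of n] by (simp add: algebra_simps)
qed

section \<open>Projections of a generation\<close>

lemma line_length_line_proj:
  "line_length \<theta> (line_proj \<theta> ` E) = emeasure lebesgue ((\<lambda>z. z \<bullet> direction \<theta>) ` E)"
proof -
  have "direction \<theta> \<noteq> 0"
    by (simp add: direction_def zero_prod_def) (metis sin_zero_norm_cos_one norm_zero zero_neq_one)
  then have "{t. t *\<^sub>R direction \<theta> \<in> line_proj \<theta> ` E} = (\<lambda>z. z \<bullet> direction \<theta>) ` E"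
    by (auto simp: line_proj_def)
  then show ?thesis
    by (simp add: line_length_def)
qed

text \<open>The shadow is a part of the projection of the square at \<open>c\<close>. Its length does not depend on
  \<open>\<theta>\<close>, unlike that of the full projection.\<close>

definition shadow :: "nat \<Rightarrow> real \<Rightarrow> real \<times> real \<Rightarrow> real set" where
  "shadow n \<theta> c = {c \<bullet> direction \<theta> .. c \<bullet> direction \<theta> + (1/4) ^ n}"

text \<open>The diagonal of the square already projects onto an interval of length
  \<open>(cos \<theta> + sin \<theta>) * (1/4) ^ n\<close>, and \<open>cos \<theta> + sin \<theta> \<ge> 1\<close> in the first quadrant.\<close>

lemma shadow_subset_projection:
  assumes "c \<in> vertices n" "\<theta> \<in> {0..1}"
  shows "shadow n \<theta> c \<subseteq> (\<lambda>z. z \<bullet> direction \<theta>) ` four_corner_gen n"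
proof
  fix t assume t: "t \<in> shadow n \<theta> c"
  \<comment> \<open>The preimage of \<open>t\<close> sought is the point of the diagonal at \<open>s / m\<close>.\<close>
  define s where "s = t - c \<bullet> direction \<theta>"
  define m where "m = cos \<theta> + sin \<theta>"
  have s: "0 \<le> s" "s \<le> (1/4) ^ n"
    using t by (auto simp: s_def shadow_def)
  have "\<theta> \<le> pi / 2"
    using assms pi_gt3 by auto
  then have cs: "0 \<le> cos \<theta>" "0 \<le> sin \<theta>"
    using assms pi_gt3 by (auto intro!: cos_ge_zero sin_ge_zero)
  have "1\<^sup>2 \<le> m\<^sup>2"
    using cs sin_cos_squared_add[of \<theta>] by (simp add: m_def power2_sum)
  then have m: "1 \<le> m"
    using cs by (intro power2_le_imp_le[of 1 m]) (auto simp: m_def)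
  have "s / m \<le> s"
    using s m divide_left_mono[of 1 m s] by simp
  then have "c + (s / m, s / m) \<in> four_corner_gen n"
    using s m by (intro square_subset_four_corner_gen assms) auto
  moreover have "(c + (s / m, s / m)) \<bullet> direction \<theta> = t"
  proof -
    have "(s / m, s / m) \<bullet> direction \<theta> = s / m * m"
      by (simp add: direction_def m_def distrib_left)
    then show ?thesis
      using m by (simp add: inner_add_left s_def)
  qed
  ultimately show "t \<in> (\<lambda>z. z \<bullet> direction \<theta>) ` four_corner_gen n"
    by force
qed

lemma emeasure_shadow_Int_le:
  assumes "\<theta> \<in> {0..1}"
  shows "emeasure lebesgue (shadow n \<theta> c \<inter> shadow n \<theta> d)
    \<le> ennreal ((1/4) ^ n) * indicator (slab_directions ((1/4) ^ n) (c - d)) \<theta>"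
proof (cases "shadow n \<theta> c \<inter> shadow n \<theta> d = {}")
  case False
  then have "\<theta> \<in> slab_directions ((1/4) ^ n) (c - d)"
    using assms by (auto simp: shadow_def slab_directions_def inner_diff_left abs_le_iff)
  moreover have "emeasure lebesgue (shadow n \<theta> c \<inter> shadow n \<theta> d)
      \<le> emeasure lebesgue (shadow n \<theta> c)"
    by (intro emeasure_mono) (auto simp: shadow_def)
  ultimately show ?thesis
    by (simp add: shadow_def)
qed simp

text \<open>The \<open>4 ^ n\<close> shadows have total length 1, which makes the left side independent of \<open>n\<close>.\<close>

lemma projection_second_moment:
  assumes \<theta>: "\<theta> \<in> {0..1}" and l: "\<mu> \<ge> 0"
  shows "ennreal (2 * \<mu>) \<le> line_length \<theta> (line_proj \<theta> ` four_corner_gen n)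
    + ennreal (\<mu>\<^sup>2 * (1/4) ^ n) * (\<Sum>c\<in>vertices n. \<Sum>d\<in>vertices n.
        indicator (slab_directions ((1/4) ^ n) (c - d)) \<theta>)"
proof -
  let ?r = "(1/4) ^ n :: real"
  have "ennreal (2 * \<mu>) = ennreal (2 * \<mu>) * (\<Sum>c\<in>vertices n. emeasure lebesgue (shadow n \<theta> c))"
  proof -
    have "(\<Sum>c\<in>vertices n. emeasure lebesgue (shadow n \<theta> c)) = (\<Sum>c\<in>vertices n. ennreal ?r)"
      by (simp add: shadow_def)
    also have "\<dots> = ennreal (\<Sum>c\<in>vertices n. ?r)"
      by (rule sum_ennreal) simp
    also have "(\<Sum>c\<in>vertices n. ?r) = 1"
      by (simp add: card_vertices power_mult_distrib[symmetric])
    finally show ?thesis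
      by simp
  qed
  also have "\<dots> \<le> emeasure lebesgue (\<Union>c\<in>vertices n. shadow n \<theta> c)
      + ennreal (\<mu>\<^sup>2) * (\<Sum>c\<in>vertices n. \<Sum>d\<in>vertices n.
          emeasure lebesgue (shadow n \<theta> c \<inter> shadow n \<theta> d))"
    using l by (intro second_moment_union_bound) (auto simp: shadow_def)
  also have "\<dots> \<le> line_length \<theta> (line_proj \<theta> ` four_corner_gen n)
      + ennreal (\<mu>\<^sup>2) * (\<Sum>c\<in>vertices n. \<Sum>d\<in>vertices n.
          ennreal ?r * indicator (slab_directions ?r (c - d)) \<theta>)"
  proof (intro add_mono mult_left_mono sum_mono emeasure_shadow_Int_le \<theta>)
    have "compact ((\<lambda>z. z \<bullet> direction \<theta>) ` four_corner_gen n)"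
      by (intro compact_continuous_image continuous_intros compact_four_corner_gen)
    then have "(\<lambda>z. z \<bullet> direction \<theta>) ` four_corner_gen n \<in> sets lebesgue"
      by (simp add: compact_imp_closed)
    then show "emeasure lebesgue (\<Union>c\<in>vertices n. shadow n \<theta> c)
        \<le> line_length \<theta> (line_proj \<theta> ` four_corner_gen n)"
      unfolding line_length_line_proj
      using shadow_subset_projection \<theta> by (intro emeasure_mono) blast+
  qed simp
  also have "ennreal (\<mu>\<^sup>2) * (\<Sum>c\<in>vertices n. \<Sum>d\<in>vertices n.
        ennreal ?r * indicator (slab_directions ?r (c - d)) \<theta>)
      = ennreal (\<mu>\<^sup>2 * ?r) * (\<Sum>c\<in>vertices n. \<Sum>d\<in>vertices n.
        indicator (slab_directions ?r (c - d)) \<theta>)"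
  proof -
    have "ennreal (\<mu>\<^sup>2 * ?r) = ennreal (\<mu>\<^sup>2) * ennreal ?r"
      by (rule ennreal_mult) simp_all
    then show ?thesis
      by (simp only: sum_distrib_left mult.assoc)
  qed
  finally show ?thesis .
qed

text \<open>The \<open>4 ^ n\<close> diagonal pairs contribute at most 1 each, and \<open>emeasure_slab_directions\<close> bounds the
  others by the energy: \<open>4 ^ n + 16 * (1/4) ^ n * (3/2 * n * 16 ^ n) = (1 + 24 * n) * 4 ^ n\<close>.\<close>

lemma pair_sum_le:
  assumes n: "n \<ge> 1"
  shows "(\<Sum>c\<in>vertices n. \<Sum>d\<in>vertices n. emeasure lebesgue (slab_directions ((1/4) ^ n) (c - d)))
    \<le> ennreal (25 * real n * 4 ^ n)"
proof -
  let ?r = "(1/4) ^ n :: real"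
  let ?b = "\<lambda>c d. (if c = d then 1 else 0) + 16 * ?r * inverse (norm (c - d :: real \<times> real))"
  have "emeasure lebesgue (slab_directions ?r (c - d)) \<le> ennreal (?b c d)" for c d
    using emeasure_slab_directions_le_one[of ?r 0] emeasure_slab_directions[of "c - d" ?r] by auto
  then have "(\<Sum>c\<in>vertices n. \<Sum>d\<in>vertices n. emeasure lebesgue (slab_directions ?r (c - d)))
      \<le> (\<Sum>c\<in>vertices n. \<Sum>d\<in>vertices n. ennreal (?b c d))"
    by (intro sum_mono)
  also have "\<dots> = ennreal (\<Sum>c\<in>vertices n. \<Sum>d\<in>vertices n. ?b c d)"
    by (simp add: sum_ennreal sum_nonneg del: ennreal_plus)
  also have "(\<Sum>c\<in>vertices n. \<Sum>d\<in>vertices n. ?b c d) = 4 ^ n + 16 * ?r * energy n"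
    by (simp add: sum.distrib energy_def sum_distrib_left card_vertices)
  also have "ennreal \<dots> \<le> ennreal (25 * real n * 4 ^ n)"
  proof (rule ennreal_leI)
    have "16 * ?r * energy n \<le> 16 * ?r * (3/2 * real n * 16 ^ n)"
      by (intro mult_left_mono energy_le) simp
    also have "\<dots> = 24 * real n * (?r * 16 ^ n)"
      by simp
    also have "?r * 16 ^ n = 4 ^ n"
      by (simp add: power_mult_distrib[symmetric])
    finally have "4 ^ n + 16 * ?r * energy n \<le> (1 + 24 * real n) * 4 ^ n"
      by (simp add: algebra_simps)
    also have "\<dots> \<le> 25 * real n * 4 ^ n"
      using n by (intro mult_right_mono) auto
    finally show "4 ^ n + 16 * ?r * energy n \<le> 25 * real n * 4 ^ n" .
  qed
  finally show ?thesis .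
qed

lemma favard_length_second_moment:
  assumes n: "n \<ge> 1" and l: "\<mu> \<ge> 0"
  shows "ennreal (2 * \<mu>) \<le> favard_length (four_corner_gen n) + ennreal (\<mu>\<^sup>2 * (25 * real n))"
proof -
  let ?r = "(1/4) ^ n :: real"
  let ?L = "\<lambda>\<theta>. line_length \<theta> (line_proj \<theta> ` four_corner_gen n)"
  let ?H = "\<lambda>\<theta>. \<Sum>c\<in>vertices n. \<Sum>d\<in>vertices n. indicator (slab_directions ?r (c - d)) \<theta> :: ennreal"
  let ?h = "\<lambda>\<theta>. ennreal (\<mu>\<^sup>2 * ?r) * ?H \<theta>"
  have "ennreal (2 * \<mu>) = (\<integral>\<^sup>+\<theta>. ennreal (2 * \<mu>) * indicator {0..1::real} \<theta> \<partial>lebesgue)"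
    by (subst nn_integral_cmult_indicator) auto
  also have "\<dots> \<le> (\<integral>\<^sup>+\<theta>. ?L \<theta> * indicator {0..1} \<theta> \<partial>lebesgue) + (\<integral>\<^sup>+\<theta>. ?h \<theta> \<partial>lebesgue)"
  proof (rule nn_integral_le_add_measurable)
    show "?h \<in> borel_measurable lebesgue"
      by measurable
    show "ennreal (2 * \<mu>) * indicator {0..1} \<theta> \<le> ?L \<theta> * indicator {0..1} \<theta> + ?h \<theta>" for \<theta>
      using projection_second_moment[OF _ l, of \<theta> n] by (auto simp: indicator_def)
    show "(\<lambda>\<theta>. ennreal (2 * \<mu>) * indicator {0..1::real} \<theta>) \<in> borel_measurable lebesgue"
      by (intro borel_measurable_times_ennreal borel_measurable_indicator) auto
    show "ennreal (2 * \<mu>) * indicator {0..1} \<theta> \<noteq> top" for \<theta> :: real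
      by (simp add: indicator_def)
  qed
  also have "\<dots> \<le> favard_length (four_corner_gen n) + ennreal (\<mu>\<^sup>2 * (25 * real n))"
  proof (rule add_mono)
    show "(\<integral>\<^sup>+\<theta>. ?L \<theta> * indicator {0..1} \<theta> \<partial>lebesgue) \<le> favard_length (four_corner_gen n)"
      unfolding favard_length_def
      using pi_gt3 by (intro nn_integral_mono) (auto simp: indicator_def)
    have "(\<integral>\<^sup>+\<theta>. ?h \<theta> \<partial>lebesgue) = ennreal (\<mu>\<^sup>2 * ?r) *
        (\<Sum>c\<in>vertices n. \<Sum>d\<in>vertices n. emeasure lebesgue (slab_directions ?r (c - d)))"
      by (simp add: nn_integral_cmult nn_integral_sum)
    also have "\<dots> \<le> ennreal (\<mu>\<^sup>2 * ?r) * ennreal (25 * real n * 4 ^ n)"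
      by (intro mult_left_mono pair_sum_le n) simp
    also have "\<dots> = ennreal (\<mu>\<^sup>2 * ?r * (25 * real n * 4 ^ n))"
      by (simp add: ennreal_mult)
    also have "\<mu>\<^sup>2 * ?r * (25 * real n * 4 ^ n) = \<mu>\<^sup>2 * (25 * real n)"
      by (simp add: field_simps power_divide)
    finally show "(\<integral>\<^sup>+\<theta>. ?h \<theta> \<partial>lebesgue) \<le> ennreal (\<mu>\<^sup>2 * (25 * real n))" .
  qed
  finally show ?thesis .
qed

theorem corollary3p2:
  shows "\<exists>c::real. c > 0 \<and>
    (\<forall>n::nat. n \<ge> 1 \<longrightarrow> favard_length (four_corner_gen n) \<ge> ennreal (c / real n))"
proof (intro exI[of _ "1/25"] conjI allI impI)
  fix n :: nat assume n: "n \<ge> 1"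
  \<comment> \<open>This maximizes \<open>2 * \<mu> - \<mu>\<^sup>2 * (25 * real n)\<close>.\<close>
  define \<mu> where "\<mu> = 1 / (25 * real n)"
  have l: "\<mu> \<ge> 0" and sq: "\<mu>\<^sup>2 * (25 * real n) = \<mu>"
    using n by (auto simp: \<mu>_def power2_eq_square)
  have "ennreal \<mu> + ennreal \<mu> \<le> favard_length (four_corner_gen n) + ennreal \<mu>"
    using favard_length_second_moment[OF n l] l by (simp add: sq flip: ennreal_plus)
  then have "ennreal \<mu> \<le> favard_length (four_corner_gen n)"
    by (simp add: ennreal_add_left_cancel_le add.commute)
  then show "ennreal (1/25 / real n) \<le> favard_length (four_corner_gen n)"
    by (simp add: \<mu>_def)
qed simp

end
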